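(* Let $A:S^1\to\mathbb{R}$ be a Lipschitz continuous function having a unique maximizing probability, let $u\in\mathcal{C}$ be its unique calibrated subaction, and let $\mathcal{G}=\mathcal{G}_A:\mathcal{C}\to\mathcal{C}$ be the associated operator. Let $f_0\in\mathcal{C}$. (1) Assume $f_0\in\mathfrak{B}$. If $|\mathcal{G}(f_0)-u|=|f_0-u|$, then $f_0=u$. Consequently, if $f_0\neq u$, then $|\mathcal{G}(f_0)-u|<|f_0-u|$. (2) Therefore, if $\mathcal{G}^n(f_0)\in\mathfrak{B}$ and $\mathcal{G}^n(f_0)\neq u$, then $|\mathcal{G}^{n+1}(f_0)-u|<|\mathcal{G}^n(f_0)-u|$.
   Context: $S^1=\mathbb{R}/\mathbb{Z}$, $T(x)=2x \pmod 1$ is the doubling map, with inverse branches $\tau_i(x)=\frac12(x+i-1)$, $i=1,2$ (for $x\in[0,1]$). $m(A):=\sup_{\rho\ T\text{-invariant}}\int A\,d\rho$ over $T$-invariant probabilities; a maximizing probability is one attaining this supremum. A calibrated subaction for $A$ is a continuous $u:S^1\to\mathbb{R}$ with $u(x)=\max_{T(y)=x}[A(y)+u(y)-m(A)]$ for all $x\in S^1$; it is known that when the maximizing probability is unique, the calibrated subaction exists and is unique up to an additive constant, i.e. unique in $\mathcal{C}$. $C^0$ is the space of continuous functions $S^1\to\mathbb{R}$ with $|f|_0=\sup|f|$, and $\mathcal{C}=C^0/\mathbb{R}$ is its quotient by the constants; in each class the representative with supremum $0$ is chosen. $\mathcal{C}$ carries the quotient norm $|f|=\inf_{\alpha\in\mathbb{R}}|f+\alpha|_0$.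 The infimum is attained at $\alpha_f:=-\frac{\max f+\min f}{2}$. The operator $\mathcal{G}_A:\mathcal{C}\to\mathcal{C}$ is $$\mathcal{G}_A(f)(x)=\frac{\max_{T(y)=x}[A(y)+f(y)]+f(x)}{2}-c_f,\qquad c_f=\sup_{s\in S^1}\frac{\max_{T(r)=s}[A(r)+f(r)]+f(s)}{2},$$ and $\mathcal{G}^n$ is its $n$-th iterate. $\mathfrak{B}\subset\mathcal{C}$ is the set of functions $f_0$ such that, for every $r$ with $|f_0-u|=|(f_0-u)+\alpha_{f_0-u}|_0=(f_0-u)(r)+\alpha_{f_0-u}$, one has $(f_0-u)(r)\neq(f_0-u)(\tau_1(r))$ and $(f_0-u)(r)\neq(f_0-u)(\tau_2(r))$. *)

theory Defs
  imports "HOL-Probability.Probability"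
begin

section \<open>The circle as a metric space\<close>

definition circle_rel :: "real \<Rightarrow> real \<Rightarrow> bool" where
  "circle_rel x y \<longleftrightarrow> x - y \<in> \<int>"

lemma equivp_circle_rel: "equivp circle_rel"
proof (rule equivpI)
  show "reflp circle_rel"
    by (simp add: reflp_def circle_rel_def)
  show "symp circle_rel"
    unfolding symp_def circle_rel_def by (metis Ints_minus minus_diff_eq)
  show "transp circle_rel"
    unfolding transp_def circle_rel_def by (metis Ints_add diff_add_cancel add_diff_eq)
qed

quotient_type circle = real / circle_rel
  morphisms rep_circle proj
  by (rule equivp_circle_rel)

lemma proj_eq_iff: "proj x = proj y \<longleftrightarrow> x - y \<in> \<int>"
  using circle.abs_eq_iff circle_rel_def by simp

lemma proj_cases: obtains t where "x = proj t"
  by (metis Quotient3_abs_rep Quotient3_circle)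

lemma dist_int_shift:
  fixes z w :: real
  assumes "z - w \<in> \<int>"
  shows "\<bar>z - of_int (round z)\<bar> = \<bar>w - of_int (round w)\<bar>"
proof -
  have *: "\<bar>a - of_int (round a)\<bar> \<le> \<bar>b - of_int (round b)\<bar>" if "a - b \<in> \<int>" for a b :: real
  proof -
    from that obtain k where k: "a - b = of_int k" by (elim Ints_cases)
    have "\<bar>a - of_int (round a)\<bar> \<le> \<bar>a - of_int (k + round b)\<bar>"
      by (rule round_diff_minimal)
    also have "\<dots> = \<bar>b - of_int (round b)\<bar>" using k by simp
    finally show ?thesis .
  qed
  have "w - z \<in> \<int>" using assms by (metis Ints_minus minus_diff_eq)
  then show ?thesis using * assms by (meson order_antisym)
qed

text \<open>The quotient metric: the distance of \<open>x - y\<close> to the nearest integer.\<close>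

instantiation circle :: metric_space
begin

lift_definition dist_circle :: "circle \<Rightarrow> circle \<Rightarrow> real" is
  "\<lambda>x y. \<bar>(x - y) - of_int (round (x - y))\<bar>"
proof (rule dist_int_shift)
  fix x1 x2 y1 y2 :: real
  assume "circle_rel x1 x2" "circle_rel y1 y2"
  then have "(x1 - x2) - (y1 - y2) \<in> \<int>"
    unfolding circle_rel_def by (rule Ints_diff)
  then show "x1 - y1 - (x2 - y2) \<in> \<int>"
    by (simp add: algebra_simps)
qed

definition uniformity_circle :: "(circle \<times> circle) filter" where
  "uniformity_circle = (INF e\<in>{0<..}. principal {(x, y). dist x y < e})"

definition open_circle :: "circle set \<Rightarrow> bool" where
  "open_circle U \<longleftrightarrow> (\<forall>x\<in>U. eventually (\<lambda>(x', y). x' = x \<longrightarrow> y \<in> U) uniformity)"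

instance
proof
  fix x y z :: circle
  show "dist x y = 0 \<longleftrightarrow> x = y"
  proof transfer
    fix a b :: real
    show "\<bar>a - b - of_int (round (a - b))\<bar> = 0 \<longleftrightarrow> circle_rel a b"
      unfolding circle_rel_def by (metis Ints_cases Ints_of_int abs_eq_0 eq_iff_diff_eq_0 round_of_int)
  qed
  show "dist x y \<le> dist x z + dist y z"
  proof transfer
    fix a b c :: real
    have "\<bar>a - b - of_int (round (a - b))\<bar> \<le> \<bar>a - b - of_int (round (a - c) - round (b - c))\<bar>"
      by (rule round_diff_minimal)
    also have "\<dots> \<le> \<bar>a - c - of_int (round (a - c))\<bar> + \<bar>b - c - of_int (round (b - c))\<bar>"
      by simp
    finally show "\<bar>a - b - of_int (round (a - b))\<bar>
      \<le> \<bar>a - c - of_int (round (a - c))\<bar> + \<bar>b - c - of_int (round (b - c))\<bar>" .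
  qed
qed (fact uniformity_circle_def open_circle_def)+

end

lemma dist_proj: "dist (proj x) (proj y) = \<bar>(x - y) - of_int (round (x - y))\<bar>"
  by (rule dist_circle.abs_eq)

lemma dist_proj_le: "dist (proj x) (proj y) \<le> dist x y"
  using round_diff_minimal[of "x - y" 0] by (simp add: dist_proj dist_real_def)

lemma continuous_on_proj: "continuous_on S proj"
  unfolding continuous_on_iff by (meson dist_proj_le le_less_trans)

text \<open>Continuous functions on the circle are the 1-periodic continuous functions on the line.\<close>

lemma continuous_on_circle_iff:
  fixes f :: "circle \<Rightarrow> 'a::metric_space"
  shows "continuous_on UNIV f \<longleftrightarrow> continuous_on UNIV (\<lambda>t. f (proj t))"
proof
  assume "continuous_on UNIV f"
  then show "continuous_on UNIV (\<lambda>t. f (proj t))"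
    by (rule continuous_on_compose2[OF _ continuous_on_proj]) auto
next
  assume c: "continuous_on UNIV (\<lambda>t. f (proj t))"
  show "continuous_on UNIV f"
    unfolding continuous_on_iff
  proof (intro ballI allI impI)
    fix x :: circle and e :: real
    assume e: "0 < e"
    obtain t where t: "x = proj t" by (rule proj_cases)
    obtain d where d: "d > 0" "\<And>s. dist s t < d \<Longrightarrow> dist (f (proj s)) (f (proj t)) < e"
      using c e unfolding continuous_on_iff by blast
    show "\<exists>d>0. \<forall>x'\<in>UNIV. dist x' x < d \<longrightarrow> dist (f x') (f x) < e"
    proof (intro exI[of _ d] conjI d(1) ballI impI)
      fix y assume y: "dist y x < d"
      obtain s where s: "y = proj s" by (rule proj_cases)
      define s' where "s' = s - of_int (round (s - t))"
      have "proj s' = y" by (simp add: s s'_def proj_eq_iff)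
      moreover have "dist s' t < d"
        using y by (simp add: s t dist_proj s'_def dist_real_def algebra_simps)
      ultimately show "dist (f y) (f x) < e" using d(2)[of s'] t by simp
    qed
  qed
qed

lemma compact_circle: "compact (UNIV :: circle set)"
proof -
  have "(UNIV :: circle set) = proj ` {0..1}"
  proof (intro equalityI subsetI)
    fix x :: circle
    obtain t where "x = proj t" by (rule proj_cases)
    then have "x = proj (frac t)" by (simp add: proj_eq_iff frac_def)
    moreover have "frac t \<in> {0..1}" using frac_lt_1[of t] by (simp add: less_imp_le)
    ultimately show "x \<in> proj ` {0..1}" by blast
  qed simp
  then show ?thesis
    by (metis compact_Icc compact_continuous_image continuous_on_proj)
qed

section \<open>The doubling map and its inverse branches\<close>

lift_definition doubling :: "circle \<Rightarrow> circle" is "\<lambda>x. 2 * x"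
  unfolding circle_rel_def by (metis Ints_mult Ints_numeral right_diff_distrib)

lift_definition unit_rep :: "circle \<Rightarrow> real" is frac
  unfolding circle_rel_def by (metis Ints_cases add_diff_cancel_left' diff_add_cancel frac_add_of_int_left)

text \<open>
  The branches are evaluated at the representative in \<open>[0, 1)\<close>; choosing 1 instead of 0
  for the base point would only interchange its two preimages.
\<close>

definition inv_branch :: "nat \<Rightarrow> circle \<Rightarrow> circle" where
  "inv_branch i x = proj ((unit_rep x + real i - 1) / 2)"

lemma doubling_proj: "doubling (proj t) = proj (2 * t)"
  by (rule doubling.abs_eq)

lemma doubling_vimage_proj: "{y. doubling y = proj t} = {proj (t / 2), proj ((t + 1) / 2)}"
proof (intro equalityI subsetI)
  fix y assume y: "y \<in> {y. doubling y = proj t}"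
  obtain s where s: "y = proj s" by (rule proj_cases)
  from y have "2 * s - t \<in> \<int>" by (simp add: s doubling_proj proj_eq_iff)
  then obtain k where k: "2 * s - t = of_int k" by (elim Ints_cases)
  show "y \<in> {proj (t / 2), proj ((t + 1) / 2)}"
  proof (cases "even k")
    case True
    then obtain j where "k = 2 * j" by blast
    then have "s - t / 2 = of_int j" using k by (simp add: field_simps)
    then show ?thesis by (simp add: s proj_eq_iff)
  next
    case False
    then obtain j where "k = 2 * j + 1" by (elim oddE)
    then have "s - (t + 1) / 2 = of_int j" using k by (simp add: field_simps)
    then show ?thesis by (simp add: s proj_eq_iff)
  qed
next
  fix y assume "y \<in> {proj (t / 2), proj ((t + 1) / 2)}"
  then show "y \<in> {y. doubling y = proj t}"
    by (auto simp: doubling_proj proj_eq_iff add_divide_distrib)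
qed

lemma doubling_vimage: "{y. doubling y = x} = {inv_branch 1 x, inv_branch 2 x}"
proof -
  obtain t where "x = proj t" by (rule proj_cases)
  then have "x = proj (unit_rep x)"
    by (simp add: unit_rep.abs_eq proj_eq_iff frac_def)
  then show ?thesis
    using doubling_vimage_proj[of "unit_rep x"] by (simp add: inv_branch_def add.commute)
qed

section \<open>Maximizing probabilities and calibrated subactions\<close>

definition invariant_prob :: "circle measure \<Rightarrow> bool" where
  "invariant_prob \<rho> \<longleftrightarrow> prob_space \<rho> \<and> sets \<rho> = sets borel \<and> distr \<rho> borel doubling = \<rho>"

definition max_value :: "(circle \<Rightarrow> real) \<Rightarrow> real" where
  "max_value A = (SUP \<rho>\<in>{\<rho>. invariant_prob \<rho>}. \<integral>x. A x \<partial>\<rho>)"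

definition maximizing_prob :: "(circle \<Rightarrow> real) \<Rightarrow> circle measure \<Rightarrow> bool" where
  "maximizing_prob A \<rho> \<longleftrightarrow> invariant_prob \<rho> \<and> (\<integral>x. A x \<partial>\<rho>) = max_value A"

definition calibrated_subaction :: "(circle \<Rightarrow> real) \<Rightarrow> (circle \<Rightarrow> real) \<Rightarrow> bool" where
  "calibrated_subaction A u \<longleftrightarrow> continuous_on UNIV u \<and>
     (\<forall>x. u x = Max ((\<lambda>y. A y + u y - max_value A) ` {y. doubling y = x}))"

section \<open>Continuous functions modulo constants\<close>

text \<open>
  A class in \<open>C\<^sup>0/\<real>\<close> is given by its representative with supremum 0. A difference of two
  such representatives need not have supremum 0, so \<open>quot_norm\<close> and \<open>centering\<close> are defined
  for arbitrary continuous functions; adding a constant to \<open>f\<close> changes neither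
  \<open>quot_norm f\<close> nor the function \<open>f + centering f\<close>.
\<close>

definition C_quot :: "(circle \<Rightarrow> real) set" where
  "C_quot = {f. continuous_on UNIV f \<and> (SUP x. f x) = 0}"

definition sup_norm :: "(circle \<Rightarrow> real) \<Rightarrow> real" where
  "sup_norm f = (SUP x. \<bar>f x\<bar>)"

definition quot_norm :: "(circle \<Rightarrow> real) \<Rightarrow> real" where
  "quot_norm f = (INF \<alpha>. sup_norm (\<lambda>x. f x + \<alpha>))"

definition centering :: "(circle \<Rightarrow> real) \<Rightarrow> real" where
  "centering f = - ((SUP x. f x) + (INF x. f x)) / 2"

definition half_step :: "(circle \<Rightarrow> real) \<Rightarrow> (circle \<Rightarrow> real) \<Rightarrow> circle \<Rightarrow> real" where
  "half_step A f x = (Max ((\<lambda>y. A y + f y) ` {y. doubling y = x}) + f x) / 2"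

definition G_op :: "(circle \<Rightarrow> real) \<Rightarrow> (circle \<Rightarrow> real) \<Rightarrow> circle \<Rightarrow> real" where
  "G_op A f x = half_step A f x - (SUP s. half_step A f s)"

lemma continuous_on_half_step:
  assumes "continuous_on UNIV A" "continuous_on UNIV f"
  shows "continuous_on UNIV (half_step A f)"
proof -
  have *: "continuous_on UNIV (\<lambda>t. A (proj t))" "continuous_on UNIV (\<lambda>t. f (proj t))"
    using assms by (simp_all add: continuous_on_circle_iff)
  have comp: "continuous_on UNIV (\<lambda>t. A (proj (h t)))" "continuous_on UNIV (\<lambda>t. f (proj (h t)))"
    if "continuous_on UNIV h" for h :: "real \<Rightarrow> real"
    using *[THEN continuous_on_compose2, OF that] by simp_all
  have "continuous_on UNIV (\<lambda>t. (max (A (proj (t / 2)) + f (proj (t / 2)))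
      (A (proj ((t + 1) / 2)) + f (proj ((t + 1) / 2))) + f (proj t)) / 2)"
    using *(2) by (intro continuous_intros comp) simp_all
  then show ?thesis
    by (subst continuous_on_circle_iff) (simp add: half_step_def doubling_vimage_proj)
qed

lemma G_op_in_C_quot:
  assumes "continuous_on UNIV A" "f \<in> C_quot"
  shows "G_op A f \<in> C_quot"
proof -
  have c: "continuous_on UNIV (half_step A f)"
    using assms by (simp add: C_quot_def continuous_on_half_step)
  obtain p where p: "\<And>x. half_step A f x \<le> half_step A f p"
    using continuous_attains_sup[OF compact_circle _ c] by auto
  then have s: "(SUP x. half_step A f x) = half_step A f p"
    by (intro cSup_eq_maximum) auto
  have "(SUP x. G_op A f x) = 0"
    by (rule cSup_eq_maximum) (auto simp: G_op_def s p intro: rev_image_eqI[of p])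
  moreover have "continuous_on UNIV (G_op A f)"
    unfolding G_op_def by (intro continuous_intros c)
  ultimately show ?thesis by (simp add: C_quot_def)
qed

definition B_set :: "(circle \<Rightarrow> real) \<Rightarrow> (circle \<Rightarrow> real) set" where
  "B_set u = {f \<in> C_quot. \<forall>r.
     (let g = f - u in
        quot_norm g = sup_norm (\<lambda>x. g x + centering g) \<and>
        sup_norm (\<lambda>x. g x + centering g) = g r + centering g \<longrightarrow>
        g r \<noteq> g (inv_branch 1 r) \<and> g r \<noteq> g (inv_branch 2 r))}"

end

theory Submission
  imports Defs
begin

text \<open>
  Write \<open>g = f - u\<close>. The quotient norm of \<open>g\<close> is half of its oscillation \<open>max g - min g\<close>
  (lemma \<open>quot_norm_eq_half_oscillation\<close>). Since \<open>u\<close> is calibrated, up to a constant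
  \<open>\<G>(f) - u\<close> is the average of \<open>g\<close> and of the function that sends \<open>x\<close> to the difference of
  \<open>max (B + g)\<close> and \<open>max B\<close> over the two preimages of \<open>x\<close>, where \<open>B = A + u\<close>. That
  difference lies between the minimum and the maximum of \<open>g\<close> on the fibre, so the average stays
  in \<open>[min g, max g]\<close>. It can equal \<open>max g\<close> at \<open>x\<close> only if \<open>g\<close> attains its maximum both
  at \<open>x\<close> and at a preimage of \<open>x\<close>, which is exactly what \<open>f \<in> \<BB>\<close> forbids. By compactness
  the maximum has then dropped strictly while the minimum has not dropped, so the oscillation is
  strictly smaller (lemma \<open>quot_norm_G_op_less\<close>).

  In particular a constant \<open>g\<close> violates the condition at every point, so \<open>u \<notin> \<BB>\<close>, and the
  inequality is strict on all of \<open>\<BB>\<close>; both parts of the theorem are instances of it.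
\<close>

lemma sup_norm_add_const:
  assumes p: "\<And>x. g x \<le> g p" and q: "\<And>x. g q \<le> g x"
  shows "sup_norm (\<lambda>x. g x + \<alpha>) = max \<bar>g p + \<alpha>\<bar> \<bar>g q + \<alpha>\<bar>"
  unfolding sup_norm_def
proof (rule cSup_eq_maximum)
  show "max \<bar>g p + \<alpha>\<bar> \<bar>g q + \<alpha>\<bar> \<in> range (\<lambda>x. \<bar>g x + \<alpha>\<bar>)"
    by (auto simp: max_def)
next
  fix y assume "y \<in> range (\<lambda>x. \<bar>g x + \<alpha>\<bar>)"
  then obtain x where "y = \<bar>g x + \<alpha>\<bar>" by auto
  then show "y \<le> max \<bar>g p + \<alpha>\<bar> \<bar>g q + \<alpha>\<bar>"
    using p[of x] q[of x] by auto
qed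

lemma centering_eq:
  assumes p: "\<And>x. g x \<le> g p" and q: "\<And>x. g q \<le> g x"
  shows "centering g = - (g p + g q) / 2"
proof -
  have "(SUP x. g x) = g p" using p by (intro cSup_eq_maximum) auto
  moreover have "(INF x. g x) = g q" using q by (intro cInf_eq_minimum) auto
  ultimately show ?thesis by (simp add: centering_def)
qed

text \<open>
  The larger of \<open>\<bar>max g + \<alpha>\<bar>\<close> and \<open>\<bar>min g + \<alpha>\<bar>\<close> is smallest when \<open>max g + \<alpha>\<close> and
  \<open>min g + \<alpha>\<close> are opposite numbers.
\<close>

lemma quot_norm_eq_half_oscillation:
  assumes p: "\<And>x. g x \<le> g p" and q: "\<And>x. g q \<le> g x"
  shows "quot_norm g = (g p - g q) / 2"
  unfolding quot_norm_def sup_norm_add_const[OF p q]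
proof (rule cInf_eq_minimum)
  have "max \<bar>g p + - (g p + g q) / 2\<bar> \<bar>g q + - (g p + g q) / 2\<bar> = (g p - g q) / 2"
    using p[of q] by (simp add: max_def abs_if field_simps)
  then show "(g p - g q) / 2 \<in> range (\<lambda>\<alpha>. max \<bar>g p + \<alpha>\<bar> \<bar>g q + \<alpha>\<bar>)"
    by (rule range_eqI[OF sym])
next
  fix y assume "y \<in> range (\<lambda>\<alpha>. max \<bar>g p + \<alpha>\<bar> \<bar>g q + \<alpha>\<bar>)"
  then obtain \<alpha> where "y = max \<bar>g p + \<alpha>\<bar> \<bar>g q + \<alpha>\<bar>" by auto
  then show "(g p - g q) / 2 \<le> y" by (simp add: max_def abs_if)
qed

lemma continuous_circle_attains_bounds:
  fixes g :: "circle \<Rightarrow> real"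
  assumes "continuous_on UNIV g"
  obtains p q where "\<And>x. g x \<le> g p" "\<And>x. g q \<le> g x"
  using continuous_attains_sup[OF compact_circle _ assms]
    continuous_attains_inf[OF compact_circle _ assms] by auto

text \<open>
  After centering, the maximum of \<open>f - u\<close> equals the quotient norm, so the points \<open>r\<close> over which
  the definition of \<open>\<BB>\<close> quantifies are exactly the maximum points of \<open>f - u\<close>.
\<close>

lemma B_set_avoids_max_on_fibre:
  assumes f: "f \<in> B_set u"
    and p: "\<And>x. (f - u) x \<le> (f - u) p" and q: "\<And>x. (f - u) q \<le> (f - u) x"
    and r: "(f - u) r = (f - u) p" and y: "doubling y = r"
  shows "(f - u) y < (f - u) p"
proof -
  let ?g = "f - u"
  have sup: "sup_norm (\<lambda>x. ?g x + centering ?g) = (?g p - ?g q) / 2"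
    unfolding sup_norm_add_const[of ?g, OF p q] centering_eq[of ?g, OF p q]
    using p[of q] by (simp add: max_def abs_if field_simps)
  have "?g r + centering ?g = (?g p - ?g q) / 2"
    unfolding centering_eq[of ?g, OF p q] r by (simp add: field_simps)
  then have "?g r \<noteq> ?g (inv_branch 1 r)" "?g r \<noteq> ?g (inv_branch 2 r)"
    using f sup quot_norm_eq_half_oscillation[of ?g, OF p q]
    unfolding B_set_def Let_def mem_Collect_eq by metis+
  moreover have "y = inv_branch 1 r \<or> y = inv_branch 2 r"
    using doubling_vimage[of r] y by blast
  ultimately show ?thesis using p[of y] r by auto
qed

text \<open>
  Since \<open>\<G>(f) - u\<close> attains its bounds on the compact circle, it is enough to confine it
  pointwise to a half-open interval \<open>[min g + c, max g + c)\<close>. The shift \<open>c\<close> collects the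
  two constants in play, the normalization of \<open>\<G>\<close> and half the maximal value of \<open>A\<close>.
\<close>

lemma quot_norm_G_op_less:
  fixes A u f :: "circle \<Rightarrow> real"
  assumes A: "continuous_on UNIV A" and u: "calibrated_subaction A u" and f: "f \<in> B_set u"
  shows "quot_norm (G_op A f - u) < quot_norm (f - u)"
proof -
  define g where "g = f - u"
  define h where "h = G_op A f - u"
  define c where "c = max_value A / 2 - (SUP s. half_step A f s)"
  have cont_u: "continuous_on UNIV u" using u unfolding calibrated_subaction_def by blast
  have f_C: "f \<in> C_quot" using f by (simp add: B_set_def)
  have cont_g: "continuous_on UNIV g"
    using f_C cont_u by (auto simp: g_def C_quot_def fun_diff_def intro: continuous_on_diff)
  have cont_h: "continuous_on UNIV h"
    using G_op_in_C_quot[OF A f_C] cont_u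
    by (auto simp: h_def C_quot_def fun_diff_def intro: continuous_on_diff)
  obtain p q where p: "\<And>x. g x \<le> g p" and q: "\<And>x. g q \<le> g x"
    using continuous_circle_attains_bounds[OF cont_g] by blast
  obtain p' q' where p': "\<And>x. h x \<le> h p'" and q': "\<And>x. h q' \<le> h x"
    using continuous_circle_attains_bounds[OF cont_h] by blast
  have bounds: "g q + c \<le> h x \<and> h x < g p + c" for x
  proof -
    define y z where "y = inv_branch 1 x" and "z = inv_branch 2 x"
    have fibre: "{y. doubling y = x} = {y, z}"
      unfolding y_def z_def by (rule doubling_vimage)
    have dy: "doubling y = x" and dz: "doubling z = x" using fibre by blast+
    have ux: "u x = max (A y + u y) (A z + u z) - max_value A"
    proof -
      have "u x = Max ((\<lambda>y. A y + u y - max_value A) ` {y. doubling y = x})"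
        using u unfolding calibrated_subaction_def by blast
      also have "\<dots> = max (A y + u y) (A z + u z) - max_value A"
        unfolding fibre by (simp add: max_def)
      finally show ?thesis .
    qed
    \<comment> \<open>The calibration equation also writes the subtracted \<open>u x\<close> as a maximum over the fibre.\<close>
    have hx: "h x = (max (A y + u y + g y) (A z + u z + g z)
        - max (A y + u y) (A z + u z) + g x) / 2 + c"
      by (simp add: h_def G_op_def half_step_def fibre g_def c_def ux field_simps)
    have strict: "g y < g p \<and> g z < g p" if "g x = g p"
      using B_set_avoids_max_on_fibre[OF f p[unfolded g_def] q[unfolded g_def]] that dy dz
      unfolding g_def by blast
    show ?thesis
    proof (cases "g x = g p")
      case True
      then show ?thesis using hx strict q[of x] q[of y] q[of z] by (auto simp: max_def)
    next
      case False
      then have "g x < g p" using p[of x] by simp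
      then show ?thesis using hx q[of x] q[of y] q[of z] p[of y] p[of z]
        by (auto simp: max_def)
    qed
  qed
  have "quot_norm h = (h p' - h q') / 2" by (rule quot_norm_eq_half_oscillation[OF p' q'])
  also have "\<dots> < (g p - g q) / 2" using bounds[of p'] bounds[of q'] by simp
  also have "\<dots> = quot_norm g" by (rule quot_norm_eq_half_oscillation[OF p q, symmetric])
  finally show ?thesis by (simp only: g_def h_def)
qed

theorem theorem16:
  fixes A u f0 :: "circle \<Rightarrow> real"
  assumes "\<exists>L. L-lipschitz_on UNIV A"
    and "\<exists>!\<rho>. maximizing_prob A \<rho>"
    and "u \<in> C_quot" and "calibrated_subaction A u"
    and "f0 \<in> C_quot"
  shows "(f0 \<in> B_set u \<longrightarrow>
            (quot_norm (G_op A f0 - u) = quot_norm (f0 - u) \<longrightarrow> f0 = u) \<and>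
            (f0 \<noteq> u \<longrightarrow> quot_norm (G_op A f0 - u) < quot_norm (f0 - u))) \<and>
         (\<forall>n. (G_op A ^^ n) f0 \<in> B_set u \<and> (G_op A ^^ n) f0 \<noteq> u \<longrightarrow>
            quot_norm ((G_op A ^^ (n + 1)) f0 - u) < quot_norm ((G_op A ^^ n) f0 - u))"
proof -
  have "continuous_on UNIV A"
    using assms(1) lipschitz_on_continuous_on by blast
  then have contraction: "quot_norm (G_op A f - u) < quot_norm (f - u)" if "f \<in> B_set u" for f
    using quot_norm_G_op_less assms(4) that by blast
  show ?thesis
    using contraction[of f0] contraction[of "(G_op A ^^ n) f0" for n] by auto
qed

end
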